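(* For $\delta\ge 0$ let $n_\delta(x)\in\mathbb{Q}[x]$ be the polynomials determined by $$\sum_{\delta \geq 0} n_\delta(x) t^\delta = \frac{1}{(1-q)^{x^2-3x} \prod_{n\ge1}(1-q^n)^3} \left(\binom{x+2}{2} - 3 \sum_{i\geq 1} \frac{q^i}{(1- q^i)^2} \right),\qquad t=\frac{q}{(1-q)^2}.$$ Then these match the Katz-Klemm-Vafa prediction for local $\mathbb{P}^2$: for all integers $d\ge 1$ and $0\le\delta\le d+2$, $$n_\delta(d)=\sum_{j=0}^{\delta}\left( \binom{2g(d)-2-j-\delta}{\delta-j} + \binom{2g(d)-3-j-\delta}{\delta-j-1} \right)\left( \binom{d+2}{2} - j \right) e\bigl((\mathbb{P}^2)^{(j)}\bigr),$$ where $g(d)=\frac{(d-1)(d-2)}{2}$.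
   Context: $(\mathbb{P}^2)^{(j)}$ is the Hilbert scheme of zero-dimensional subschemes of length $j$ of $\mathbb{P}^2$, and $e$ is the topological Euler characteristic (by Göttsche's formula $\sum_j e((\mathbb{P}^2)^{(j)})q^j=\prod_{n\ge1}(1-q^n)^{-3}$). Binomial coefficients are $\binom{a}{k}=a(a-1)\cdots(a-k+1)/k!$ for $k\ge0$ (any $a$) and $\binom{a}{k}=0$ for $k<0$. The right-hand side of the last formula is the Katz-Klemm-Vafa prediction for $(-1)^{(d^2+3d)/2+\delta}\,n^{g(d)-\delta}_d$, with $n^g_d$ the Gopakumar-Vafa invariants of the total space of $\mathcal{O}_{\mathbb{P}^2}(-3)$; and $n_\delta(d)$ denotes the polynomial that equals $(-1)^{g(d)+d-1-\delta}n^{g(d)-\delta}_d$ for $d\ge\delta+2$. In $\sum n_\delta(x)t^\delta$, the variables $t$ and $q$ are formal variables related by the invertible substitution $t=q/(1-q)^2$. *)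

theory Defs
  imports "HOL-Analysis.Analysis"
begin

unbundle no vec_syntax
unbundle fps_syntax

(* \<open>k\<close> ranges over the integers, with value 0 for \<open>k < 0\<close>; \<open>a\<close> may be negative. *)
definition binom :: "rat \<Rightarrow> int \<Rightarrow> rat" where
  "binom a k = (if k < 0 then 0 else a gchoose nat k)"

(* \<open>(1 - q)\<close> to an arbitrary power, by the binomial series. *)
definition one_minus_q_powr :: "rat \<Rightarrow> rat fps" where
  "one_minus_q_powr a = fps_binomial a oo (- fps_X)"

(* The variable \<open>q\<close> is \<open>fps_X\<close>. Infinite products and sums are limits in the
   X-adic topology of \<open>rat fps\<close>; indices start at 0, hence the \<open>Suc\<close>.
   By Goettsche's formula, \<open>1 / euler_prod ^ 3\<close> is the generating function of the
   topological Euler characteristics \<open>e j\<close> of the Hilbert schemes of length \<open>j\<close>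
   subschemes of the projective plane. The libraries have no Hilbert schemes, so
   the numbers \<open>e j\<close> are specified by this formula. *)
definition euler_prod :: "rat fps" where
  "euler_prod = (\<Prod>n. 1 - fps_X ^ Suc n)"

(* The right-hand side of the defining equation of the \<open>n\<^sub>\<delta>\<close>, evaluated at a rational
   \<open>x\<close>. Its coefficients are polynomial in \<open>x\<close>, so the equation over \<open>\<rat>[x]\<close> is the
   same as its instances at all rational \<open>x\<close>. *)
definition n_series :: "rat \<Rightarrow> rat fps" where
  "n_series x = 1 / (one_minus_q_powr (x\<^sup>2 - 3 * x) * euler_prod ^ 3) *
     (fps_const (binom (x + 2) 2) - 3 * (\<Sum>i. fps_X ^ Suc i / (1 - fps_X ^ Suc i)\<^sup>2))"

definition t_series :: "rat fps" where
  "t_series = fps_X / (1 - fps_X)\<^sup>2"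

definition genus :: "int \<Rightarrow> rat" where
  "genus d = of_int ((d - 1) * (d - 2)) / 2"

(* The infinite product and sum above converge, so \<open>prodinf\<close> and \<open>suminf\<close> have
   their intended values, and the \<open>n\<^sub>\<delta>\<close> exist and are unique. *)

lemma has_prod_euler_prod: "(\<lambda>n. 1 - fps_X ^ Suc n :: rat fps) has_prod euler_prod"
  and LIMSEQ_euler_prod: "(\<lambda>n. \<Prod>i\<le>n. 1 - fps_X ^ Suc i :: rat fps) \<longlonglongrightarrow> euler_prod"
proof -
  define P where "P n = (\<Prod>i\<le>n. 1 - fps_X ^ Suc i :: rat fps)" for n
  have step: "P (Suc n) $ k = P n $ k" if "k \<le> n" for n k
    using that by (simp add: P_def right_diff_distrib fps_X_power_mult_right_nth
        flip: power_Suc)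
  have stable: "P n $ k = P k $ k" if "k \<le> n" for n k
    using that by (induction n rule: dec_induct) (auto simp: step)
  define p where "p = Abs_fps (\<lambda>k. P k $ k)"
  have "P \<longlonglongrightarrow> p"
    by (rule tendsto_fpsI)
      (auto simp: p_def intro!: eventually_sequentiallyI stable)
  moreover have "p $ 0 = 1"
    by (simp add: p_def P_def)
  then have "p \<noteq> 0" by auto
  moreover have nz: "1 - fps_X ^ Suc n \<noteq> (0 :: rat fps)" for n
  proof
    assume "1 - fps_X ^ Suc n = (0 :: rat fps)"
    then have "(1 - fps_X ^ Suc n :: rat fps) $ 0 = 0" by (simp only: fps_zero_nth)
    then show False by simp
  qed
  ultimately have iff: "(\<lambda>n. 1 - fps_X ^ Suc n :: rat fps) has_prod q \<longleftrightarrow> q = p" for q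
    unfolding has_prod_def raw_has_prod_def P_def[abs_def]
    by (auto dest: LIMSEQ_unique simp del: power_Suc)
  then have "euler_prod = p"
    unfolding euler_prod_def prodinf_def iff by simp
  with iff \<open>P \<longlonglongrightarrow> p\<close>
  show "(\<lambda>n. 1 - fps_X ^ Suc n :: rat fps) has_prod euler_prod"
    and "(\<lambda>n. \<Prod>i\<le>n. 1 - fps_X ^ Suc i :: rat fps) \<longlonglongrightarrow> euler_prod"
    by (simp_all only: P_def[abs_def])
qed

lemma summable_n_series:
  "summable (\<lambda>i. fps_X ^ Suc i / (1 - fps_X ^ Suc i)\<^sup>2 :: rat fps)"
proof -
  define f where "f i = (fps_X ^ Suc i / (1 - fps_X ^ Suc i)\<^sup>2 :: rat fps)" for i
  have z: "f i $ k = 0" if "k \<le> i" for i k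
  proof -
    have "f i = fps_X ^ Suc i * inverse ((1 - fps_X ^ Suc i)\<^sup>2)"
      unfolding f_def by (rule fps_divide_unit) (simp add: fps_power_zeroth)
    also have "\<dots> $ k = 0"
      using that by (simp add: fps_X_power_mult_nth del: power_Suc)
    finally show ?thesis .
  qed
  define s where "s = Abs_fps (\<lambda>k. (\<Sum>i<k. f i) $ k)"
  have stable: "(\<Sum>i<n. f i) $ k = (\<Sum>i<k. f i) $ k" if "k \<le> n" for n k
    using that by (induction n rule: dec_induct) (auto simp: z)
  have "(\<lambda>n. \<Sum>i<n. f i) \<longlonglongrightarrow> s"
    by (rule tendsto_fpsI)
      (auto simp: s_def intro!: eventually_sequentiallyI stable)
  then have "f sums s" by (simp add: sums_def)
  then show ?thesis
    unfolding f_def[abs_def] summable_def by blast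
qed

lemma n_series_coeff_poly: "\<exists>r. \<forall>x k. n_series x $ k = poly (r k) x"
proof -
  define pf where "pf F \<longleftrightarrow> (\<exists>r. \<forall>x k. F x $ k = poly (r k) x)" for F :: "rat \<Rightarrow> rat fps"
  have pf_mult: "pf (\<lambda>x. F x * G x)" if "pf F" "pf G" for F G
  proof -
    from that obtain r s where r: "\<And>x k. F x $ k = poly (r k) x"
      and s: "\<And>x k. G x $ k = poly (s k) x"
      unfolding pf_def by blast
    show ?thesis unfolding pf_def
      by (rule exI[of _ "\<lambda>k. \<Sum>i=0..k. r i * s (k - i)"])
        (simp add: fps_mult_nth r s poly_sum)
  qed
  have pf_const: "pf (\<lambda>x. C)" for C
    unfolding pf_def by (rule exI[of _ "\<lambda>k. [:C $ k:]"]) simp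
  have pf_diff: "pf (\<lambda>x. F x - G x)" if "pf F" "pf G" for F G
  proof -
    from that obtain r s where r: "\<And>x k. F x $ k = poly (r k) x"
      and s: "\<And>x k. G x $ k = poly (s k) x"
      unfolding pf_def by blast
    show ?thesis unfolding pf_def
      by (rule exI[of _ "\<lambda>k. r k - s k"]) (simp add: r s)
  qed
  have gpoly: "poly (smult (1 / fact k) (\<Prod>i=0..<k. p - [:of_nat i:])) x = poly p x gchoose k"
    for k and p :: "rat poly" and x
    by (simp add: gbinomial_prod_rev poly_prod)
  have pf_binom: "pf (\<lambda>x. fps_const (binom (x + 2) 2))"
    unfolding pf_def
    by (rule exI[of _ "\<lambda>k. if k = 0 then smult (1 / fact 2) (\<Prod>i=0..<2. [:2, 1:] - [:of_nat i:]) else 0"])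
      (simp only: if_distrib[of "\<lambda>p. poly p _"] gpoly, simp add: binom_def add.commute)
  have neg_one_pow: "((- fps_X) ^ k :: rat fps) = fps_const ((-1) ^ k) * fps_X ^ k" for k
    by (metis fps_const_neg fps_const_1_eq_1 fps_const_power mult_minus1 power_mult_distrib)
  have pow_nth: "one_minus_q_powr a $ k = (-1) ^ k * (a gchoose k)" for a k
    unfolding one_minus_q_powr_def fps_compose_nth neg_one_pow
    by (simp add: fps_X_power_nth if_distrib cong: if_cong)
  have pow_inv: "inverse (one_minus_q_powr a) = one_minus_q_powr (- a)" for a
  proof (rule fps_inverse_unique)
    have "one_minus_q_powr a * one_minus_q_powr (- a) = fps_binomial (a + - a) oo (- fps_X)"
      unfolding one_minus_q_powr_def fps_binomial_add_mult
      by (simp add: fps_compose_mult_distrib)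
    also have "fps_binomial (a + - a) = (1 :: rat fps)"
      using fps_binomial_of_nat[of 0, where 'a = rat] by simp
    finally show "one_minus_q_powr a * one_minus_q_powr (- a) = 1" by simp
  qed
  have pf_pow: "pf (\<lambda>x. one_minus_q_powr (- (x\<^sup>2 - 3 * x)))"
    unfolding pf_def
    by (rule exI[of _ "\<lambda>k. smult ((-1) ^ k) (smult (1 / fact k) (\<Prod>i=0..<k. [:0, 3, -1:] - [:of_nat i:]))"])
      (simp only: poly_smult[of "(-1) ^ _"] gpoly pow_nth, simp add: power2_eq_square algebra_simps)
  define S where "S = (\<Sum>i. fps_X ^ Suc i / (1 - fps_X ^ Suc i)\<^sup>2 :: rat fps)"
  have "pf (\<lambda>x. one_minus_q_powr (- (x\<^sup>2 - 3 * x)) * inverse (euler_prod ^ 3)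
      * (fps_const (binom (x + 2) 2) - 3 * S))"
    by (intro pf_mult pf_diff pf_const pf_binom pf_pow)
  moreover have "euler_prod $ 0 = 1"
  proof -
    have "\<forall>\<^sub>F n in sequentially. (\<Prod>i\<le>n. 1 - fps_X ^ Suc i :: rat fps) $ 0 = euler_prod $ 0"
      using LIMSEQ_euler_prod unfolding tendsto_fps_iff by blast
    then obtain n where "(\<Prod>i\<le>n. 1 - fps_X ^ Suc i :: rat fps) $ 0 = euler_prod $ 0"
      by (metis (mono_tags, lifting) eventually_sequentially order_refl)
    moreover have "(\<Prod>i\<le>n. 1 - fps_X ^ Suc i :: rat fps) $ 0 = 1"
      by (induction n) simp_all
    ultimately show ?thesis by simp
  qed
  then have "n_series x = one_minus_q_powr (- (x\<^sup>2 - 3 * x)) * inverse (euler_prod ^ 3)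
      * (fps_const (binom (x + 2) 2) - 3 * S)" for x
    unfolding n_series_def S_def[symmetric] pow_inv[symmetric]
    by (subst fps_divide_unit) (simp_all add: pow_nth fps_power_zeroth fps_inverse_mult)
  ultimately show ?thesis by (simp add: pf_def)
qed

lemma n_unique_existence:
  "\<exists>!n :: nat \<Rightarrow> rat poly. \<forall>x. Abs_fps (\<lambda>\<delta>. poly (n \<delta>) x) oo t_series = n_series x"
proof -
  have t: "t_series = fps_X * inverse ((1 - fps_X)\<^sup>2)"
    unfolding t_series_def by (rule fps_divide_unit) (simp add: fps_power_zeroth)
  have t0: "t_series $ 0 = 0" and t1: "t_series $ 1 \<noteq> 0"
    by (simp_all add: t fps_power_zeroth)
  define u where "u = fps_inv t_series"
  have u: "u oo t_series = fps_X" and u0: "u $ 0 = 0"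
    using t0 t1 by (simp_all add: u_def fps_inv) (simp add: fps_inv_def)
  obtain r where r: "\<And>x k. n_series x $ k = poly (r k) x"
    using n_series_coeff_poly by blast
  define n where "n \<delta> = (\<Sum>k=0..\<delta>. smult ((u ^ k) $ \<delta>) (r k))" for \<delta>
  have "Abs_fps (\<lambda>\<delta>. poly (n \<delta>) x) = n_series x oo u" for x
    by (simp add: fps_eq_iff fps_compose_nth n_def poly_sum r mult.commute)
  then have n: "\<forall>x. Abs_fps (\<lambda>\<delta>. poly (n \<delta>) x) oo t_series = n_series x"
    using u by (simp add: fps_compose_assoc[symmetric] t0 u0)
  show ?thesis
  proof (rule ex1I[of _ n])
    show "\<forall>x. Abs_fps (\<lambda>\<delta>. poly (n \<delta>) x) oo t_series = n_series x" by (fact n)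
  next
    fix m :: "nat \<Rightarrow> rat poly"
    assume "\<forall>x. Abs_fps (\<lambda>\<delta>. poly (m \<delta>) x) oo t_series = n_series x"
    then have "Abs_fps (\<lambda>\<delta>. poly (m \<delta>) x) = Abs_fps (\<lambda>\<delta>. poly (n \<delta>) x)" for x
      using n fps_compose_inj_right[OF t0 t1] by metis
    then have "poly (m \<delta>) x = poly (n \<delta>) x" for \<delta> x
      by (metis fps_nth_Abs_fps)
    then show "m = n"
      by (intro ext poly_ext)
  qed
qed

end

theory Submission
  imports Defs
begin

text \<open>Let \<open>E = \<Sum>\<^sub>j e\<^sub>j q\<^sup>j\<close>. Logarithmic differentiation of \<open>\<Prod>(1 - q\<^sup>i)\<close> together with the symmetry
  of the double sum \<open>\<Sum>\<^sub>i\<^sub>,\<^sub>m m q\<^bsup>im\<^esup>\<close> turns the series defining the \<open>n\<^sub>\<delta>(d)\<close> into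
  \<open>(1 - q)\<^bsup>-(2g-2)\<^esup> \<Sum>\<^sub>j (binom(d+2, 2) - j) e\<^sub>j q\<^sup>j\<close>. Lagrange inversion for \<open>t = q/(1 - q)\<^sup>2\<close> gives
  \<open>[t\<^sup>\<delta>] H = [q\<^sup>\<delta>] H (1 - q)\<^bsup>2\<delta>-1\<^esup> (1 + q)\<close>, and expanding the binomial series yields the formula.\<close>

section \<open>Rational powers of \<open>1 - q\<close>\<close>

lemma one_minus_q_powr_nth: "one_minus_q_powr a $ k = (-1) ^ k * (a gchoose k)"
proof -
  have neg_X_power: "((- fps_X) ^ k :: rat fps) = fps_const ((-1) ^ k) * fps_X ^ k" for k
    by (metis fps_const_neg fps_const_1_eq_1 fps_const_power mult_minus1 power_mult_distrib)
  show ?thesis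
    unfolding one_minus_q_powr_def fps_compose_nth neg_X_power
    by (simp add: fps_X_power_nth if_distrib cong: if_cong)
qed

text \<open>Upper negation absorbs the sign \<open>(-1)^k\<close>; this form produces the binomials
  of the final formula directly.\<close>

lemma one_minus_q_powr_minus_nth:
  "one_minus_q_powr (- b) $ k = (b + of_nat k - 1) gchoose k"
  by (simp add: one_minus_q_powr_nth gbinomial_minus flip: power_mult_distrib mult.assoc)

lemma one_minus_q_powr_add: "one_minus_q_powr (a + b) = one_minus_q_powr a * one_minus_q_powr b"
  unfolding one_minus_q_powr_def fps_binomial_add_mult
  by (simp add: fps_compose_mult_distrib)

lemma one_minus_q_powr_0: "one_minus_q_powr 0 = 1"
  by (rule fps_ext) (simp add: one_minus_q_powr_nth gbinomial_0_left)

lemma one_minus_q_powr_of_nat: "one_minus_q_powr (of_nat n) = (1 - fps_X) ^ n"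
proof (induction n)
  case (Suc n)
  have "one_minus_q_powr 1 = 1 - fps_X"
  proof (rule fps_ext)
    fix k :: nat
    have "one_minus_q_powr 1 $ k = (-1) ^ k * of_nat (1 choose k)"
      by (simp add: one_minus_q_powr_nth binomial_gbinomial)
    also have "\<dots> = (1 - fps_X) $ k"
    proof (cases "k \<le> 1")
      case True
      then show ?thesis by (cases k) auto
    next
      case False
      then show ?thesis by (simp add: binomial_eq_0)
    qed
    finally show "one_minus_q_powr 1 $ k = (1 - fps_X) $ k" .
  qed
  with Suc show ?case by (simp add: one_minus_q_powr_add)
qed (simp add: one_minus_q_powr_0)

lemma inverse_one_minus_q_powr: "inverse (one_minus_q_powr a) = one_minus_q_powr (- a)"
  by (rule fps_inverse_unique) (simp add: one_minus_q_powr_0 flip: one_minus_q_powr_add)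

section \<open>Lagrange inversion for \<open>t = q/(1 - q)^2\<close>\<close>

lemma t_series_power: "t_series ^ k = fps_X ^ k * one_minus_q_powr (- 2 * of_nat k)"
proof -
  have "t_series = fps_X * inverse ((1 - fps_X)\<^sup>2)"
    unfolding t_series_def by (rule fps_divide_unit) (simp add: fps_power_zeroth)
  also have "inverse ((1 - fps_X)\<^sup>2) = one_minus_q_powr (- 2)"
    using one_minus_q_powr_of_nat[of 2] by (simp flip: inverse_one_minus_q_powr)
  finally have t: "t_series = fps_X * one_minus_q_powr (- 2)" .
  show ?thesis
  proof (induction k)
    case (Suc k)
    have "- 2 * of_nat (Suc k) = (- 2 :: rat) + - 2 * of_nat k" by simp
    then show ?case
      by (simp only: power_Suc Suc one_minus_q_powr_add) (simp add: t algebra_simps)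
  qed (simp add: one_minus_q_powr_0)
qed

text \<open>The coefficients \<open>binom(2m-1, m)\<close> and \<open>binom(2m-1, m-1)\<close> cancel by symmetry.\<close>

lemma lagrange_kernel_nth:
  "(one_minus_q_powr (2 * of_nat m - 1) * (1 + fps_X)) $ m = (if m = 0 then 1 else 0)"
proof (cases m)
  case (Suc l)
  define N where "N = 2 * l + 1"
  have N: "2 * of_nat m - 1 = (of_nat N :: rat)" by (simp add: Suc N_def)
  have "N choose Suc l = N choose l"
    unfolding N_def by (subst binomial_symmetric) simp_all
  then have "(of_nat N gchoose Suc l) = (of_nat N gchoose l :: rat)"
    by (simp only: flip: binomial_gbinomial)
  then show ?thesis
    unfolding N by (simp add: Suc distrib_left one_minus_q_powr_nth)
qed (simp add: one_minus_q_powr_nth)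

text \<open>The coefficient is the residue of \<open>H dt / t^(n+1)\<close>. Since
  \<open>dt/dq = (1 + q)/(1 - q)^3\<close>, this is the \<open>q^n\<close> coefficient of
  \<open>H (1 - q)^(2n-1) (1 + q)\<close>. The proof replaces residues by a duality between the
  powers of \<open>t\<close> and this kernel.\<close>

lemma lagrange_t_series:
  assumes "F oo t_series = H"
  shows "F $ n = (H * (one_minus_q_powr (2 * of_nat n - 1) * (1 + fps_X))) $ n"
proof -
  define G where "G = one_minus_q_powr (2 * of_nat n - 1) * (1 + fps_X)"
  have low: "(t_series ^ k) $ i = 0" if "i < k" for i k
    using that by (simp add: t_series_power fps_X_power_mult_nth)
  \<comment> \<open>\<open>t^k\<close> starts at \<open>q^k\<close>, so one range
    \<open>0..n\<close> serves every \<open>i \<le> n\<close> and the double sum below can be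
    swapped.\<close>
  have H: "H $ i = (\<Sum>k=0..n. F $ k * (t_series ^ k) $ i)" if "i \<le> n" for i
    unfolding assms[symmetric] fps_compose_nth
    using that by (intro sum.mono_neutral_left) (auto simp: low)
  \<comment> \<open>Multiplying the kernel for \<open>n\<close> by \<open>t^k\<close> gives
    \<open>q^k\<close> times the kernel for \<open>n - k\<close>, so the previous lemma applies with
    \<open>m = n - k\<close>.\<close>
  have orth: "(t_series ^ k * G) $ n = (if k = n then 1 else 0)" if "k \<le> n" for k
  proof -
    have "2 * of_nat (n - k) - 1 = - 2 * of_nat k + (2 * of_nat n - 1 :: rat)"
      using that by (simp add: of_nat_diff)
    then have "t_series ^ k * G =
        fps_X ^ k * (one_minus_q_powr (2 * of_nat (n - k) - 1) * (1 + fps_X))"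
      by (simp only: G_def t_series_power one_minus_q_powr_add mult.assoc)
    then show ?thesis
      using that by (simp only: fps_X_power_mult_nth lagrange_kernel_nth) auto
  qed
  have "(H * G) $ n = (\<Sum>i=0..n. \<Sum>k=0..n. F $ k * ((t_series ^ k) $ i * G $ (n - i)))"
    by (simp add: fps_mult_nth H sum_distrib_right mult.assoc)
  also have "\<dots> = (\<Sum>k=0..n. F $ k * (t_series ^ k * G) $ n)"
    by (subst sum.swap) (simp add: fps_mult_nth sum_distrib_left)
  also have "\<dots> = (\<Sum>k=0..n. if k = n then F $ k else 0)"
    by (intro sum.cong) (auto simp: orth)
  finally show ?thesis by (simp add: G_def)
qed

section \<open>Lambert series and divisor sums\<close>

text \<open>For \<open>m > 0\<close> this is the geometric series \<open>1/(1 - q^m)\<close>, given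
  by coefficients to expose divisibility.\<close>

definition multiples_fps :: "nat \<Rightarrow> rat fps" where
  "multiples_fps m = Abs_fps (\<lambda>k. if m dvd k then 1 else 0)"

lemma multiples_fps_mult:
  assumes "m > 0"
  shows "multiples_fps m * (1 - fps_X ^ m) = 1"
proof (rule fps_ext)
  fix k
  have "m dvd k - m \<longleftrightarrow> m dvd k" if "m \<le> k" using that by (simp add: dvd_minus_self)
  moreover have "m dvd k \<longleftrightarrow> k = 0" if "k < m" using that by (auto dest: dvd_imp_le)
  ultimately show "(multiples_fps m * (1 - fps_X ^ m)) $ k = 1 $ k"
    using assms by (auto simp: right_diff_distrib fps_X_power_mult_right_nth multiples_fps_def)
qed

text \<open>This is \<open>y/(1 - y)^2 = \<Sum> c y^c\<close> at \<open>y = q^m\<close>. One factor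
  \<open>1 - q^m\<close> takes the claimed series \<open>h\<close> to
  \<open>multiples_fps m - 1\<close>, the second takes that to \<open>q^m\<close>.\<close>

lemma lambert_term_nth:
  assumes "m > 0"
  shows "(fps_X ^ m / (1 - fps_X ^ m)\<^sup>2 :: rat fps) $ k
    = (if m dvd k then of_nat (k div m) else 0)"
proof -
  define h :: "rat fps" where "h = Abs_fps (\<lambda>k. if m dvd k then of_nat (k div m) else 0)"
  have "h * (1 - fps_X ^ m) = multiples_fps m - 1"
  proof (rule fps_ext)
    fix k
    have "m dvd k - m \<longleftrightarrow> m dvd k" if "m \<le> k" using that by (simp add: dvd_minus_self)
    moreover have "m dvd k \<longleftrightarrow> k = 0" if "k < m" using that by (auto dest: dvd_imp_le)
    moreover have "k div m = Suc ((k - m) div m)" if "m \<le> k"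
      using assms that by (simp add: le_div_geq)
    ultimately show "(h * (1 - fps_X ^ m)) $ k = (multiples_fps m - 1) $ k"
      using assms
      by (auto simp: right_diff_distrib fps_X_power_mult_right_nth multiples_fps_def h_def)
  qed
  then have "h * (1 - fps_X ^ m)\<^sup>2 = multiples_fps m * (1 - fps_X ^ m) - (1 - fps_X ^ m)"
    unfolding power2_eq_square mult.assoc[symmetric]
    by (simp only: left_diff_distrib mult_1_left)
  then have h: "h * (1 - fps_X ^ m)\<^sup>2 = fps_X ^ m"
    using assms by (simp add: multiples_fps_mult)
  have "((1 - fps_X ^ m)\<^sup>2 :: rat fps) $ 0 \<noteq> 0"
    using assms by (simp add: fps_power_zeroth zero_power)
  then have "((1 - fps_X ^ m)\<^sup>2 :: rat fps) \<noteq> 0" by (metis fps_zero_nth)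
  from nonzero_mult_div_cancel_right[OF this, of h]
  have "fps_X ^ m / (1 - fps_X ^ m)\<^sup>2 = h"
    unfolding h .
  then show ?thesis by (simp add: h_def)
qed

text \<open>The terms contribute \<open>k div m\<close> for each divisor \<open>m\<close> of
  \<open>k\<close>; passing to complementary divisors gives the sum of the divisors themselves, the
  form in which the logarithmic derivative of the product arises.\<close>

lemma lambert_series_nth:
  "(\<Sum>i. fps_X ^ Suc i / (1 - fps_X ^ Suc i)\<^sup>2 :: rat fps) $ k
    = (\<Sum>i<k. if Suc i dvd k then of_nat (Suc i) else 0)" (is "suminf ?f $ k = _")
proof -
  have "(\<lambda>n. \<Sum>i<n. ?f i) \<longlonglongrightarrow> suminf ?f"
    using summable_LIMSEQ[OF summable_n_series] .
  then have "\<forall>\<^sub>F n in sequentially. (\<Sum>i<n. ?f i) $ k = suminf ?f $ k"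
    unfolding tendsto_fps_iff by blast
  then obtain N where N: "\<And>n. n \<ge> N \<Longrightarrow> (\<Sum>i<n. ?f i) $ k = suminf ?f $ k"
    unfolding eventually_sequentially by blast
  have fk: "?f i $ k = (if Suc i dvd k then of_nat (k div Suc i) else 0)" for i
    by (rule lambert_term_nth) simp
  \<comment> \<open>\<open>max N k\<close> makes the partial sum both stable and long enough to meet
    every divisor of a positive \<open>k\<close>.\<close>
  have "suminf ?f $ k = (\<Sum>i<max N k. ?f i $ k)"
    using N[of "max N k"] by (simp only: fps_sum_nth max.cobounded1)
  \<comment> \<open>An index \<open>i \<ge> k\<close> passes the divisibility test only for
    \<open>k = 0\<close>, where the quotient is 0.\<close>
  also have "\<dots> = (\<Sum>i<k. if Suc i dvd k then of_nat (k div Suc i) else 0)"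
    unfolding fk by (intro sum.mono_neutral_right) (auto dest: dvd_imp_le simp: div_eq_0_iff)
  also have "\<dots> = (\<Sum>i\<in>{i\<in>{..<k}. Suc i dvd k}. of_nat (k div Suc i))"
    by (rule sum.inter_filter[symmetric]) simp
  also have "\<dots> = (\<Sum>i\<in>{i\<in>{..<k}. Suc i dvd k}. of_nat (Suc i))"
  proof -
    \<comment> \<open>The involution \<open>m -> k div m\<close> on divisors, shifted by one because
      \<open>m = Suc i\<close>.\<close>
    have codivisor: "k div (k div Suc i) - 1 = i" "k div Suc i - 1 \<in> {i\<in>{..<k}. Suc i dvd k}"
      "Suc (k div Suc i - 1) = k div Suc i" if i: "i \<in> {i\<in>{..<k}. Suc i dvd k}" for i
    proof -
      from i obtain c where c: "k = Suc i * c" and "k > 0"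
        by (metis dvdE gr_zeroI lessThan_iff mem_Collect_eq not_less_zero)
      then have "c > 0" by (metis mult_is_0 not_gr_zero)
      then have "k div Suc i = c" "k div c = Suc i" "c dvd k" "c \<le> k"
        unfolding c by (simp_all del: mult_Suc)
      then show "k div (k div Suc i) - 1 = i" "k div Suc i - 1 \<in> {i\<in>{..<k}. Suc i dvd k}"
          "Suc (k div Suc i - 1) = k div Suc i"
        using \<open>c > 0\<close> by auto
    qed
    show ?thesis
      by (rule sum.reindex_bij_witness[where i = "\<lambda>i. k div Suc i - 1" and j = "\<lambda>i. k div Suc i - 1"])
        (simp_all only: codivisor)
  qed
  also have "\<dots> = (\<Sum>i<k. if Suc i dvd k then of_nat (Suc i) else 0)"
    by (rule sum.inter_filter) simp
  finally show ?thesis .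
qed

section \<open>Logarithmic derivative of the Euler product\<close>

lemma X_deriv_nth: "(fps_X * fps_deriv f) $ k = of_nat k * (f $ k :: rat)"
  by (cases k) (simp_all del: of_nat_Suc)

text \<open>Each factor has logarithmic derivative
  \<open>q d/dq log(1 - q^m) = -m q^m/(1 - q^m)\<close>, and \<open>q^m/(1 - q^m)\<close> is
  \<open>multiples_fps m - 1\<close>. Multiplying by the product keeps logarithms out.\<close>

lemma X_deriv_partial_euler_prod:
  "fps_X * fps_deriv (\<Prod>i<n. 1 - fps_X ^ Suc i) =
    - (\<Prod>i<n. 1 - fps_X ^ Suc i) * (\<Sum>i<n. of_nat (Suc i) * (multiples_fps (Suc i) - 1))"
proof (induction n)
  case (Suc n)
  define P :: "rat fps" where "P = (\<Prod>i<n. 1 - fps_X ^ Suc i)"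
  define T where "T = (\<Sum>i<n. of_nat (Suc i) * (multiples_fps (Suc i) - 1))"
  define M where "M = multiples_fps (Suc n)"
  define c :: "rat fps" where "c = of_nat (Suc n)"
  define Y :: "rat fps" where "Y = fps_X ^ Suc n"
  have "fps_X * fps_deriv Y = c * Y"
    by (rule fps_ext) (simp add: X_deriv_nth Y_def c_def fps_mult_of_nat_nth del: power_Suc of_nat_Suc)
  then have dY: "fps_X * fps_deriv (1 - Y) = - (c * Y)" by simp
  have IH: "fps_X * fps_deriv P = - P * T"
    using Suc by (simp add: P_def T_def)
  have "M * (1 - Y) = 1"
    unfolding M_def Y_def by (rule multiples_fps_mult) simp
  \<comment> \<open>This form of \<open>Y\<close> makes the new factor \<open>1 - Y\<close> reappear
    in its own derivative.\<close>
  then have Y: "Y = (M - 1) * (1 - Y)" by (simp add: algebra_simps)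
  have "fps_X * fps_deriv (P * (1 - Y)) = P * (fps_X * fps_deriv (1 - Y)) + (fps_X * fps_deriv P) * (1 - Y)"
    by (simp only: fps_deriv_mult) (simp only: algebra_simps)
  also have "\<dots> = - P * (c * ((M - 1) * (1 - Y))) - P * T * (1 - Y)"
    unfolding dY IH by (subst Y) (simp add: algebra_simps)
  also have "\<dots> = - (P * (1 - Y)) * (T + c * (M - 1))"
    by (simp add: algebra_simps)
  finally show ?case
    by (simp only: prod.lessThan_Suc sum.lessThan_Suc P_def T_def M_def Y_def c_def)
qed simp

text \<open>Factors \<open>1 - q^m\<close> with \<open>m > k\<close> do not change the coefficient
  of \<open>q^k\<close>.\<close>

lemma euler_prod_nth:
  assumes "k \<le> n"
  shows "(\<Prod>i<n. 1 - fps_X ^ Suc i :: rat fps) $ k = euler_prod $ k"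
proof -
  define P where "P n = (\<Prod>i<n. 1 - fps_X ^ Suc i :: rat fps)" for n
  have step: "P (Suc n) $ k = P n $ k" if "k \<le> n" for n k
    using that by (simp add: P_def right_diff_distrib fps_X_power_mult_right_nth
        flip: power_Suc)
  have stable: "P n $ k = P k $ k" if "k \<le> n" for n k
    using that by (induction n rule: dec_induct) (auto simp: step)
  \<comment> \<open>The known limit concerns products over \<open>i \<le> n\<close>, hence
    \<open>Suc n\<close>.\<close>
  have "\<forall>\<^sub>F n in sequentially. P (Suc n) $ k = euler_prod $ k"
    using LIMSEQ_euler_prod unfolding tendsto_fps_iff P_def lessThan_Suc_atMost by blast
  then obtain N where "\<And>n. n \<ge> N \<Longrightarrow> P (Suc n) $ k = euler_prod $ k"
    unfolding eventually_sequentially by blast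
  then have "P (Suc (max N k)) $ k = euler_prod $ k" by simp
  moreover have "P (Suc (max N k)) $ k = P k $ k" by (rule stable) simp
  ultimately have "P n $ k = euler_prod $ k" using stable[OF assms] by metis
  then show ?thesis by (simp only: P_def)
qed

text \<open>In degrees up to \<open>k\<close>, the first \<open>k\<close> factors and the first
  \<open>k\<close> summands determine both sides, so the finite identity suffices.\<close>

lemma X_deriv_euler_prod:
  "fps_X * fps_deriv euler_prod =
    - euler_prod * (\<Sum>i. fps_X ^ Suc i / (1 - fps_X ^ Suc i)\<^sup>2)"
proof (rule fps_ext)
  fix k
  define P where "P = (\<Prod>i<k. 1 - fps_X ^ Suc i :: rat fps)"
  define T where "T = (\<Sum>i<k. of_nat (Suc i) * (multiples_fps (Suc i) - 1))"
  define S :: "rat fps" where "S = (\<Sum>i. fps_X ^ Suc i / (1 - fps_X ^ Suc i)\<^sup>2)"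
  have P: "P $ j = euler_prod $ j" if "j \<le> k" for j
    unfolding P_def using that by (rule euler_prod_nth)
  have T: "T $ j = S $ j" if "j \<le> k" for j
  proof -
    \<comment> \<open>The guard \<open>j > 0\<close> reflects the \<open>- 1\<close> in
      \<open>T\<close>, which removes only the constant terms.\<close>
    have "T $ j = (\<Sum>i<k. if j > 0 \<and> Suc i dvd j then of_nat (Suc i) else 0)"
      unfolding T_def fps_sum_nth
      by (intro sum.cong) (auto simp: multiples_fps_def fps_mult_of_nat_nth simp del: of_nat_Suc)
    also have "\<dots> = (\<Sum>i<j. if j > 0 \<and> Suc i dvd j then of_nat (Suc i) else 0)"
      using that by (intro sum.mono_neutral_right) (auto dest: dvd_imp_le)
    also have "\<dots> = S $ j"
      unfolding S_def lambert_series_nth by (intro sum.cong) auto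
    finally show ?thesis .
  qed
  have "(fps_X * fps_deriv euler_prod) $ k = (fps_X * fps_deriv P) $ k"
    by (simp only: X_deriv_nth P order_refl)
  also have "\<dots> = - (P * T) $ k"
    unfolding P_def T_def X_deriv_partial_euler_prod by simp
  also have "\<dots> = - (euler_prod * S) $ k"
    by (simp add: fps_mult_nth P T)
  finally show "(fps_X * fps_deriv euler_prod) $ k = (- euler_prod * S) $ k" by simp
qed

section \<open>The defining series and its coefficients\<close>

text \<open>Since \<open>E\<close> is the inverse cube of the Euler product,
  \<open>q dE/dq = 3 E S\<close> with \<open>S\<close> the Lambert series. Subtracting
  \<open>3 E S\<close> therefore subtracts \<open>j\<close> times the \<open>j\<close>-th
  coefficient of \<open>E\<close>.\<close>

lemma n_series_eq:
  fixes E :: "rat fps"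
  assumes "E = 1 / euler_prod ^ 3"
  shows "n_series x = one_minus_q_powr (- (x\<^sup>2 - 3 * x)) *
    Abs_fps (\<lambda>j. (binom (x + 2) 2 - of_nat j) * E $ j)"
proof -
  define S :: "rat fps" where "S = (\<Sum>i. fps_X ^ Suc i / (1 - fps_X ^ Suc i)\<^sup>2)"
  have p0: "euler_prod $ 0 = 1"
    using euler_prod_nth[of 0 0] by simp
  then have p30: "(euler_prod ^ 3) $ 0 \<noteq> 0" by (simp add: fps_power_zeroth)
  have pnz: "euler_prod \<noteq> 0" using p0 by auto
  have E: "E = inverse (euler_prod ^ 3)"
    unfolding assms using fps_divide_unit[OF p30, of 1] by simp
  have Ep: "E * euler_prod ^ 3 = 1"
    unfolding E by (rule inverse_mult_eq_1[OF p30])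
  \<comment> \<open>Differentiating \<open>E * euler_prod ^ 3 = 1\<close> avoids the derivative of a
    quotient; the cube is cancelled afterwards.\<close>
  have "fps_deriv (E * euler_prod ^ 3) = 0" by (simp add: Ep)
  then have "fps_deriv E * euler_prod ^ 3 + E * (3 * (fps_deriv euler_prod * euler_prod\<^sup>2)) = 0"
    by (simp add: fps_deriv_power numeral_fps_const algebra_simps)
  then have "fps_X * (fps_deriv E * euler_prod ^ 3 + E * (3 * (fps_deriv euler_prod * euler_prod\<^sup>2))) = 0"
    by simp
  then have "(fps_X * fps_deriv E) * euler_prod ^ 3
      + 3 * E * (fps_X * fps_deriv euler_prod) * euler_prod\<^sup>2 = 0"
    by (simp only: algebra_simps)
  then have "(fps_X * fps_deriv E - 3 * E * S) * euler_prod ^ 3 = 0"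
    unfolding X_deriv_euler_prod S_def[symmetric]
    by (simp add: algebra_simps power2_eq_square power3_eq_cube)
  then have dE: "fps_X * fps_deriv E = 3 * E * S" using pnz by simp
  have q0: "(one_minus_q_powr (x\<^sup>2 - 3 * x) * euler_prod ^ 3) $ 0 \<noteq> 0"
    using p30 by (simp add: one_minus_q_powr_nth)
  have "n_series x = one_minus_q_powr (- (x\<^sup>2 - 3 * x)) * (fps_const (binom (x + 2) 2) * E - 3 * E * S)"
    unfolding n_series_def S_def[symmetric] fps_divide_unit[OF q0]
    by (simp add: fps_inverse_mult inverse_one_minus_q_powr E algebra_simps)
  also have "fps_const (binom (x + 2) 2) * E - 3 * E * S
      = Abs_fps (\<lambda>j. (binom (x + 2) 2 - of_nat j) * E $ j)"
    unfolding dE[symmetric] by (rule fps_ext) (simp only: fps_sub_nth X_deriv_nth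
      fps_mult_left_const_nth fps_nth_Abs_fps left_diff_distrib)
  finally show ?thesis .
qed

theorem theorem5p18:
  fixes n :: "nat \<Rightarrow> rat poly"
    and e :: "nat \<Rightarrow> int"
    and d :: int
    and \<delta> :: nat
  assumes n_genfun: "\<And>x :: rat. Abs_fps (\<lambda>\<delta>. poly (n \<delta>) x) oo t_series = n_series x"
    and goettsche: "Abs_fps (\<lambda>j. of_int (e j)) = 1 / euler_prod ^ 3"
    and "d \<ge> 1"
    and "int \<delta> \<le> d + 2"
  shows "poly (n \<delta>) (of_int d) =
    (\<Sum>j = 0..\<delta>.
      (binom (2 * genus d - 2 - of_nat j - of_nat \<delta>) (int \<delta> - int j)
        + binom (2 * genus d - 3 - of_nat j - of_nat \<delta>) (int \<delta> - int j - 1))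
      * (binom (of_int d + 2) 2 - of_nat j)
      * of_int (e j))"
proof -
  define x :: rat where "x = of_int d"
  define a where "a = x\<^sup>2 - 3 * x"
  define c where "c = (\<lambda>j. (binom (x + 2) 2 - of_nat j) * of_int (e j))"
  \<comment> \<open>The genus formula for plane curves: \<open>d^2 - 3d = 2g(d) - 2\<close>.\<close>
  have a: "a = 2 * genus d - 2"
    by (simp add: a_def x_def genus_def power2_eq_square algebra_simps)
  have "Abs_fps (\<lambda>\<delta>. poly (n \<delta>) x) oo t_series = one_minus_q_powr (- a) * Abs_fps c"
    using n_series_eq[OF goettsche, of x] by (simp add: n_genfun a_def c_def)
  from lagrange_t_series[OF this, of \<delta>]
  have "poly (n \<delta>) x = (Abs_fps c * ((one_minus_q_powr (- a) * one_minus_q_powr (2 * of_nat \<delta> - 1))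
      * (1 + fps_X))) $ \<delta>"
    by (simp add: mult_ac)
  \<comment> \<open>The exponent is kept as \<open>-b\<close> so that its coefficients take the form
    \<open>binom(b + k - 1, k)\<close>.\<close>
  also have "one_minus_q_powr (- a) * one_minus_q_powr (2 * of_nat \<delta> - 1)
      = one_minus_q_powr (- (a + 1 - 2 * of_nat \<delta>))"
    by (simp add: algebra_simps flip: one_minus_q_powr_add)
  also have "(Abs_fps c * (one_minus_q_powr (- (a + 1 - 2 * of_nat \<delta>)) * (1 + fps_X))) $ \<delta>
      = (\<Sum>j = 0..\<delta>. (binom (a - of_nat j - of_nat \<delta>) (int \<delta> - int j)
        + binom (a - 1 - of_nat j - of_nat \<delta>) (int \<delta> - int j - 1)) * c j)"
    unfolding fps_mult_nth[of "Abs_fps c"]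
  proof (intro sum.cong refl)
    fix j assume "j \<in> {0..\<delta>}"
    then obtain m where m: "\<delta> = j + m" by (auto simp: le_iff_add)
    define b where "b = a + 1 - 2 * of_nat \<delta>"
    have "(one_minus_q_powr (- b) * (1 + fps_X)) $ (\<delta> - j)
      = binom (a - of_nat j - of_nat \<delta>) (int \<delta> - int j)
        + binom (a - 1 - of_nat j - of_nat \<delta>) (int \<delta> - int j - 1)"
    proof (cases m)
      \<comment> \<open>For \<open>j = \<delta>\<close> the second binomial has lower index -1 and
        is 0 by convention, just as the factor \<open>q\<close> in \<open>1 + q\<close> adds nothing
        to the constant term.\<close>
      case 0
      then show ?thesis by (simp add: m distrib_left one_minus_q_powr_nth binom_def)
    next
      case (Suc l)
      \<comment> \<open>The summands 1 and \<open>q\<close> of \<open>1 + q\<close> pick the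
        coefficients at \<open>m\<close> and \<open>m - 1\<close>; with
        \<open>m = \<delta> - j\<close> the upper indices become \<open>a - j - \<delta>\<close> and
        \<open>a - 1 - j - \<delta>\<close>.\<close>
      then have "(int \<delta> - int j < 0) = False" "(int \<delta> - int j - 1 < 0) = False"
        "nat (int \<delta> - int j) = Suc l" "nat (int \<delta> - int j - 1) = l"
        "b + of_nat (Suc l) - 1 = a - of_nat j - of_nat \<delta>"
        "b + of_nat l - 1 = a - 1 - of_nat j - of_nat \<delta>"
        by (simp_all add: m b_def)
      moreover have "(one_minus_q_powr (- b) * (1 + fps_X)) $ (\<delta> - j)
          = (b + of_nat (Suc l) - 1 gchoose Suc l) + (b + of_nat l - 1 gchoose l)"
        by (simp add: m Suc distrib_left del: of_nat_Suc flip: one_minus_q_powr_minus_nth)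
      ultimately show ?thesis by (simp only: binom_def if_False)
    qed
    then show "Abs_fps c $ j * (one_minus_q_powr (- (a + 1 - 2 * of_nat \<delta>)) * (1 + fps_X)) $ (\<delta> - j)
      = (binom (a - of_nat j - of_nat \<delta>) (int \<delta> - int j)
        + binom (a - 1 - of_nat j - of_nat \<delta>) (int \<delta> - int j - 1)) * c j"
      by (simp only: b_def fps_nth_Abs_fps mult.commute)
  qed
  finally show ?thesis
    by (simp add: a c_def x_def mult.assoc algebra_simps)
qed

end
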